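(* Let $X$ be a non-empty compact metric space. Then $$\overline{\dim}_M(X) = \min\{ \overline{\dim}_M(\mu) : \mu \text{ is a fully supported finite Borel measure on } X \},$$ $$\underline{\dim}_M(X) = \min\{ \underline{\dim}_M(\mu) : \mu \text{ is a fully supported finite Borel measure on } X \}.$$ In particular both minima are attained (values in $[0,\infty]$ are allowed).
   Context: $B(x,r)$ is the closed ball of centre $x$ and radius $r$. An $r$-packing is a countable collection of pairwise disjoint closed balls all of radius $r$, and $N_r(X)=\max\{\#\mathcal{B} : \mathcal{B}\text{ is an } r\text{-packing}\}$, which is finite for compact $X$. The upper and lower Minkowski dimensions of $X$ are $$\overline{\dim}_M(X)=\limsup_{r\downarrow 0}\frac{\log N_r(X)}{-\log r},\qquad \underline{\dim}_M(X)=\liminf_{r\downarrow 0}\frac{\log N_r(X)}{-\log r}.$$ A Borel measure $\mu$ on $X$ is fully supported if its support is $X$. For a fully supported finite Borel measure $\mu$ on $X$: $\overline{\dim}_M(\mu)$ is the infimum of all $s\ge 0$ for which there is a constant $c>0$ with $\mu(B(x,r))\ge c r^s$ for all $x\in X$ and $0<r<1$; $\underline{\dim}_M(\mu)$ is the infimum of all $s\ge 0$ for which there are a constant $c>0$ and a sequence $(r_n)_{n\in\mathbb{N}}$ of positive real numbers with $\lim_{n\to\infty} r_n=0$ such that $\mu(B(x,r_n))\ge c r_n^s$ for all $x\in X$ and $n\in\mathbb{N}$. The infimum of the empty set is $\infty$. *)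

theory Defs
  imports "HOL-Analysis.Analysis"
begin

text \<open>
  A metric space is given as a subset \<open>X\<close> of a type of class \<open>metric_space\<close>, with the
  induced metric. All notions below are intrinsic to \<open>X\<close>: balls are centred in \<open>X\<close> and
  intersected with \<open>X\<close>, and measures live on \<open>X\<close>, not on the ambient type.
\<close>

definition cball_in :: "'a::metric_space set \<Rightarrow> 'a \<Rightarrow> real \<Rightarrow> 'a set" where
  "cball_in X x r = X \<inter> cball x r"

definition packing :: "'a::metric_space set \<Rightarrow> real \<Rightarrow> 'a set set \<Rightarrow> bool" where
  "packing X r \<B> \<longleftrightarrow> countable \<B> \<and> \<B> \<subseteq> {cball_in X x r | x. x \<in> X} \<and> disjoint \<B>"

text \<open>
  \<open>card\<close> and \<open>Max\<close> are meaningful only if packings are finite and of bounded cardinality;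
  \<open>finite_packing\<close> and \<open>finite_card_packings\<close> below show this for compact \<open>X\<close> and \<open>r > 0\<close>.
\<close>

definition packing_number :: "'a::metric_space set \<Rightarrow> real \<Rightarrow> nat" where
  "packing_number X r = Max {card \<B> | \<B>. packing X r \<B>}"

lemma packing_bound:
  fixes X :: "'a::metric_space set"
  assumes "compact X" "r > 0"
  shows "\<exists>n. \<forall>\<B>. packing X r \<B> \<longrightarrow> finite \<B> \<and> card \<B> \<le> n"
proof -
  have "seq_compact X" using assms(1) by (simp add: compact_eq_seq_compact_metric)
  then have "\<exists>K. finite K \<and> K \<subseteq> X \<and> X \<subseteq> (\<Union>k\<in>K. ball k (r/2))"
    using seq_compact_imp_totally_bounded assms(2) half_gt_zero by blast
  then obtain K where K: "finite K" "X \<subseteq> (\<Union>k\<in>K. ball k (r/2))" by blast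
  have "finite \<B> \<and> card \<B> \<le> card K" if P: "packing X r \<B>" for \<B>
  proof -
    have "\<forall>B\<in>\<B>. \<exists>x. x \<in> X \<and> B = cball_in X x r"
      using P by (auto simp: packing_def)
    then obtain c where c: "\<And>B. B \<in> \<B> \<Longrightarrow> c B \<in> X \<and> B = cball_in X (c B) r"
      by metis
    have "\<forall>B\<in>\<B>. \<exists>k. k \<in> K \<and> c B \<in> ball k (r/2)"
      using K(2) c by blast
    then obtain f where f: "\<And>B. B \<in> \<B> \<Longrightarrow> f B \<in> K \<and> c B \<in> ball (f B) (r/2)"
      by metis
    have "inj_on f \<B>"
    proof (rule inj_onI)
      fix A B assume AB: "A \<in> \<B>" "B \<in> \<B>" "f A = f B"
      have "dist (f A) (c A) < r/2" "dist (f A) (c B) < r/2"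
        using f AB by (metis mem_ball)+
      then have "dist (c A) (c B) \<le> r"
        by (smt (verit) dist_triangle3 field_sum_of_halves)
      then have "c B \<in> cball_in X (c A) r" "c B \<in> cball_in X (c B) r"
        using c[OF AB(2), THEN conjunct1] assms(2) by (simp_all add: cball_in_def)
      then have "A \<inter> B \<noteq> {}" using c AB by blast
      then show "A = B" using P AB unfolding packing_def disjoint_def by blast
    qed
    moreover have "f ` \<B> \<subseteq> K" using f by blast
    ultimately show ?thesis
      using K(1) by (meson inj_on_finite card_inj_on_le)
  qed
  then show ?thesis by blast
qed

lemma finite_packing:
  assumes "compact X" "r > 0" "packing X r \<B>"
  shows "finite \<B>"
  using packing_bound assms by blast

lemma finite_card_packings:
  assumes "compact X" "r > 0"
  shows "finite {card \<B> | \<B>. packing X r \<B>}"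
proof -
  obtain n where "\<forall>\<B>. packing X r \<B> \<longrightarrow> finite \<B> \<and> card \<B> \<le> n"
    using packing_bound assms by blast
  then have "{card \<B> | \<B>. packing X r \<B>} \<subseteq> {..n}" by blast
  then show ?thesis using finite_subset by blast
qed

definition upper_minkowski_dim :: "'a::metric_space set \<Rightarrow> ereal" where
  "upper_minkowski_dim X =
     Limsup (at_right 0) (\<lambda>r. ereal (ln (real (packing_number X r)) / - ln r))"

definition lower_minkowski_dim :: "'a::metric_space set \<Rightarrow> ereal" where
  "lower_minkowski_dim X =
     Liminf (at_right 0) (\<lambda>r. ereal (ln (real (packing_number X r)) / - ln r))"

definition finite_borel_measure_on :: "'a::metric_space set \<Rightarrow> 'a measure \<Rightarrow> bool" where
  "finite_borel_measure_on X \<mu> \<longleftrightarrow> sets \<mu> = sets (restrict_space borel X) \<and> finite_measure \<mu>"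

definition measure_support :: "'a::metric_space measure \<Rightarrow> 'a set" where
  "measure_support \<mu> =
     {x \<in> space \<mu>. \<forall>U. open U \<and> x \<in> U \<longrightarrow> emeasure \<mu> (space \<mu> \<inter> U) > 0}"

definition fully_supported_measures :: "'a::metric_space set \<Rightarrow> 'a measure set" where
  "fully_supported_measures X = {\<mu>. finite_borel_measure_on X \<mu> \<and> measure_support \<mu> = X}"

text \<open>
  The infima are taken in \<open>ereal\<close>, so that the infimum of the empty set is \<open>\<infinity>\<close>.
\<close>

definition upper_minkowski_dim_measure :: "'a::metric_space set \<Rightarrow> 'a measure \<Rightarrow> ereal" where
  "upper_minkowski_dim_measure X \<mu> =
     Inf {ereal s | s. s \<ge> 0 \<and>
       (\<exists>c>0. \<forall>x\<in>X. \<forall>r. 0 < r \<and> r < 1 \<longrightarrow> measure \<mu> (cball_in X x r) \<ge> c * r powr s)}"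

definition lower_minkowski_dim_measure :: "'a::metric_space set \<Rightarrow> 'a measure \<Rightarrow> ereal" where
  "lower_minkowski_dim_measure X \<mu> =
     Inf {ereal s | s. s \<ge> 0 \<and>
       (\<exists>c>0. \<exists>\<rho> :: nat \<Rightarrow> real. (\<forall>n. \<rho> n > 0) \<and> \<rho> \<longlonglongrightarrow> 0 \<and>
         (\<forall>x\<in>X. \<forall>n. measure \<mu> (cball_in X x (\<rho> n)) \<ge> c * \<rho> n powr s))}"

definition is_minimum :: "'b::order \<Rightarrow> 'b set \<Rightarrow> bool" where
  "is_minimum m S \<longleftrightarrow> m \<in> S \<and> (\<forall>s\<in>S. m \<le> s)"

end

theory Submission
  imports Defs "HOL-Probability.Probability_Mass_Function" "HOL-Real_Asymp.Real_Asymp"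
begin

text \<open>
  Write \<open>N(r)\<close> for the packing number of \<open>X\<close>. Two opposite estimates give the theorem.

  If every ball of radius \<open>r\<close> has mass at least \<open>c * r powr s\<close>, then the disjoint balls of a
  maximum packing have total mass at least \<open>N(r) * c * r powr s\<close>, and this is at most the finite
  total mass. Taking logarithms, the exponent \<open>ln N(r) / - ln r\<close> is at most \<open>s\<close> up to an
  error that vanishes as \<open>r\<close> tends to \<open>0\<close>. So no measure has smaller dimension than
  \<open>X\<close> (\<open>upper_minkowski_dim_le_measure\<close>, \<open>lower_minkowski_dim_le_measure\<close>).

  For the converse, one measure attains both minima. Let \<open>C n\<close> be the centres of a maximum packing
  at radius \<open>(1/2) ^ n\<close>. Distribute mass \<open>scale_weight n\<close> uniformly over \<open>C n\<close> and
  add up over \<open>n\<close>. By maximality every point of \<open>X\<close> is within \<open>2 * (1/2) ^ n\<close> of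
  \<open>C n\<close>, so every ball of that radius has mass at least \<open>scale_weight n / N((1/2) ^ n)\<close>
  (\<open>obtain_multiscale_measure\<close>). The weights are summable but decay only polynomially in
  \<open>n\<close>, hence more slowly than any positive power of the radius; they cost an arbitrarily small
  amount in the exponent (\<open>scale_weight_subexponential\<close>). A bound \<open>N(r) \<le> K * r powr - t\<close>
  at all scales, or at arbitrarily small ones, thus becomes the mass bound with any exponent \<open>s > t\<close>
  at all scales, respectively at arbitrarily small ones.
\<close>

section \<open>Packings described by their centres\<close>

text \<open>
  A packing is a set of balls, and a ball of \<open>X\<close> may have several centres. Choosing one
  centre per ball makes it possible to change the radius and to add points.
\<close>

definition packing_centres :: "'a::metric_space set \<Rightarrow> real \<Rightarrow> 'a set \<Rightarrow> bool" where
  "packing_centres X r C \<longleftrightarrow> finite C \<and> C \<subseteq> X \<and>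
     (\<forall>x\<in>C. \<forall>y\<in>C. x \<noteq> y \<longrightarrow> cball_in X x r \<inter> cball_in X y r = {})"

lemma centre_in_cball_in: "x \<in> X \<Longrightarrow> r > 0 \<Longrightarrow> x \<in> cball_in X x r"
  by (simp add: cball_in_def)

lemma cball_in_mono: "r \<le> r' \<Longrightarrow> cball_in X x r \<subseteq> cball_in X x r'"
  by (auto simp: cball_in_def)

lemma card_packing_centres_le:
  assumes "compact X" "r > 0" "packing_centres X r C"
  shows "card C \<le> packing_number X r"
proof -
  let ?\<B> = "(\<lambda>x. cball_in X x r) ` C"
  have C: "finite C" "C \<subseteq> X"
    "\<And>x y. x \<in> C \<Longrightarrow> y \<in> C \<Longrightarrow> x \<noteq> y \<Longrightarrow> cball_in X x r \<inter> cball_in X y r = {}"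
    using assms(3) by (auto simp: packing_centres_def)
  have "inj_on (\<lambda>x. cball_in X x r) C"
  proof (rule inj_onI, rule ccontr)
    fix x y assume "x \<in> C" "y \<in> C" "cball_in X x r = cball_in X y r" "x \<noteq> y"
    with C centre_in_cball_in[of x X r] \<open>r > 0\<close> show False by blast
  qed
  then have card: "card ?\<B> = card C" by (rule card_image)
  have "packing X r ?\<B>"
    unfolding packing_def disjoint_def using C by (fastforce simp: countable_finite)
  then have "card ?\<B> \<in> {card \<B> | \<B>. packing X r \<B>}" by blast
  then show ?thesis
    unfolding packing_number_def card[symmetric]
    using finite_card_packings[OF assms(1,2)] by (rule Max_ge[rotated])
qed

lemma obtain_packing_centres:
  assumes "compact X" "r > 0"
  obtains C where "packing_centres X r C" "card C = packing_number X r"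
proof -
  have "packing X r {}" by (simp add: packing_def)
  then have "packing_number X r \<in> {card \<B> | \<B>. packing X r \<B>}"
    unfolding packing_number_def using finite_card_packings[OF assms] by (intro Max_in) auto
  then obtain \<B> where \<B>: "packing X r \<B>" "card \<B> = packing_number X r" by auto
  have fin: "finite \<B>" using finite_packing[OF assms \<B>(1)] .
  have "\<forall>B\<in>\<B>. \<exists>x. x \<in> X \<and> B = cball_in X x r"
    using \<B>(1) by (auto simp: packing_def)
  then obtain c where c: "\<And>B. B \<in> \<B> \<Longrightarrow> c B \<in> X \<and> B = cball_in X (c B) r"
    by metis
  have inj: "inj_on c \<B>" by (rule inj_onI) (metis c)
  have "packing_centres X r (c ` \<B>)"
    unfolding packing_centres_def
  proof (intro conjI ballI impI)
    fix x y assume "x \<in> c ` \<B>" "y \<in> c ` \<B>" "x \<noteq> y"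
    then obtain A B where "A \<in> \<B>" "B \<in> \<B>" "x = c A" "y = c B" "A \<noteq> B" by blast
    moreover from this have "A \<inter> B = {}"
      using \<B>(1) by (auto simp: packing_def disjoint_def)
    ultimately show "cball_in X x r \<inter> cball_in X y r = {}" using c by metis
  qed (use fin c in auto)
  then show thesis using that \<B>(2) card_image[OF inj] by simp
qed

lemma packing_number_ge_1:
  assumes "compact X" "X \<noteq> {}" "r > 0"
  shows "packing_number X r \<ge> 1"
proof -
  obtain x where "x \<in> X" using assms(2) by blast
  then have "packing_centres X r {x}" by (auto simp: packing_centres_def)
  from card_packing_centres_le[OF assms(1,3) this] show ?thesis by simp
qed

text \<open>
  Shrinking the balls of a packing about the same centres keeps them disjoint.
\<close>

lemma packing_number_antimono:
  assumes "compact X" "0 < r" "r \<le> r'"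
  shows "packing_number X r' \<le> packing_number X r"
proof -
  obtain C where C: "packing_centres X r' C" "card C = packing_number X r'"
    using obtain_packing_centres[of X r'] assms by auto
  have "packing_centres X r C"
    using C(1) cball_in_mono[OF assms(3), of X] unfolding packing_centres_def by blast
  then show ?thesis using card_packing_centres_le[OF assms(1,2)] C(2) by metis
qed

text \<open>
  If the ball of radius \<open>r\<close> about \<open>x\<close> missed all balls of the packing, then \<open>x\<close>
  could be added as a centre. So it meets one of them, and the triangle inequality yields the factor \<open>2\<close>.
\<close>

lemma maximum_packing_centres_dense:
  assumes "compact X" "r > 0" "packing_centres X r C" "card C = packing_number X r" "x \<in> X"
  obtains y where "y \<in> C" "y \<in> cball_in X x (2 * r)"
proof (cases "x \<in> C")
  case True
  then show ?thesis using that centre_in_cball_in[of x X "2 * r"] assms by auto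
next
  case False
  have fin: "finite C" using assms(3) by (simp add: packing_centres_def)
  have "\<not> packing_centres X r (insert x C)"
    using card_packing_centres_le[OF assms(1,2), of "insert x C"] False fin assms(4) by auto
  then obtain y where y: "y \<in> C" "cball_in X x r \<inter> cball_in X y r \<noteq> {}"
    using assms(3,5) unfolding packing_centres_def by (auto simp: Int_commute)
  then obtain z where "dist x z \<le> r" "dist y z \<le> r" by (auto simp: cball_in_def)
  then have "dist x y \<le> 2 * r" using dist_triangle2[of x y z] by linarith
  then show ?thesis using that y(1) assms(3) by (auto simp: cball_in_def packing_centres_def)
qed

section \<open>Every measure bounds the dimension from above\<close>

lemma space_finite_borel_measure_on:
  "finite_borel_measure_on X \<mu> \<Longrightarrow> space \<mu> = X"
  using sets_eq_imp_space_eq[of \<mu> "restrict_space borel X"]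
  by (simp add: finite_borel_measure_on_def space_restrict_space)

lemma cball_in_sets: "cball_in X x r \<in> sets (restrict_space borel X)"
  unfolding sets_restrict_space cball_in_def by auto

lemma packing_number_mass_bound:
  assumes "compact X" "r > 0" "finite_borel_measure_on X \<mu>"
    and "\<And>x. x \<in> X \<Longrightarrow> m \<le> measure \<mu> (cball_in X x r)"
  shows "real (packing_number X r) * m \<le> measure \<mu> X"
proof -
  interpret finite_measure \<mu> using assms(3) by (simp add: finite_borel_measure_on_def)
  have sets: "cball_in X x r \<in> sets \<mu>" for x
    using assms(3) cball_in_sets by (auto simp: finite_borel_measure_on_def)
  obtain C where C: "packing_centres X r C" "card C = packing_number X r"
    using obtain_packing_centres[OF assms(1,2)] .
  have "real (packing_number X r) * m = (\<Sum>x\<in>C. m)" by (simp add: C(2))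
  also have "\<dots> \<le> (\<Sum>x\<in>C. measure \<mu> (cball_in X x r))"
    using C(1) assms(4) by (intro sum_mono) (auto simp: packing_centres_def)
  also have "\<dots> = measure \<mu> (\<Union>x\<in>C. cball_in X x r)"
    using C(1) sets
    by (intro finite_measure_finite_Union[symmetric])
       (auto simp: packing_centres_def disjoint_family_on_def)
  also have "\<dots> \<le> measure \<mu> (space \<mu>)"
    by (rule bounded_measure)
  finally show ?thesis by (simp add: space_finite_borel_measure_on[OF assms(3)])
qed

text \<open>
  The logarithmic form of the mass bound. The last summand is the error that vanishes as \<open>r\<close> tends
  to \<open>0\<close>.
\<close>

lemma packing_exponent_le:
  assumes "compact X" "X \<noteq> {}" "0 < r" "r < 1" "c > 0" "finite_borel_measure_on X \<mu>"
    and "\<And>x. x \<in> X \<Longrightarrow> c * r powr s \<le> measure \<mu> (cball_in X x r)"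
  shows "ln (real (packing_number X r)) / - ln r \<le> s + ln (measure \<mu> X / c) / - ln r"
proof -
  let ?N = "real (packing_number X r)"
  have N: "?N \<ge> 1" using packing_number_ge_1[OF assms(1-3)] by simp
  have le: "?N * (c * r powr s) \<le> measure \<mu> X"
    by (rule packing_number_mass_bound[OF assms(1,3,6,7)])
  have "0 < ?N * (c * r powr s)" using N assms by simp
  with le have pos: "measure \<mu> X > 0" by linarith
  have "ln (?N * (c * r powr s)) \<le> ln (measure \<mu> X)"
    using le \<open>0 < ?N * (c * r powr s)\<close> pos by simp
  moreover have "ln (?N * (c * r powr s)) = ln ?N + (ln c + s * ln r)"
    using N assms by (simp add: ln_mult ln_powr)
  moreover have "ln (measure \<mu> X / c) = ln (measure \<mu> X) - ln c"
    using pos assms by (simp add: ln_div)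
  ultimately have "ln ?N \<le> s * (- ln r) + ln (measure \<mu> X / c)" by simp
  moreover have "- ln r > 0" using assms by simp
  ultimately show ?thesis by (simp add: field_simps)
qed

lemma exponent_error_tendsto:
  fixes s b :: real
  shows "((\<lambda>r. ereal (s + b / - ln r)) \<longlongrightarrow> ereal s) (at_right 0)"
proof -
  have "((\<lambda>r. s + b / - ln r) \<longlongrightarrow> s) (at_right 0)" by real_asymp
  then show ?thesis by simp
qed

lemma upper_minkowski_dim_le_measure:
  assumes "compact X" "X \<noteq> {}" "finite_borel_measure_on X \<mu>"
  shows "upper_minkowski_dim X \<le> upper_minkowski_dim_measure X \<mu>"
  unfolding upper_minkowski_dim_measure_def
proof (rule Inf_greatest, clarify)
  fix s c :: real
  assume "c > 0" and *: "\<forall>x\<in>X. \<forall>r. 0 < r \<and> r < 1 \<longrightarrow> c * r powr s \<le> measure \<mu> (cball_in X x r)"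
  let ?g = "\<lambda>r. ereal (s + ln (measure \<mu> X / c) / - ln r)"
  have "\<forall>\<^sub>F r in at_right 0. ereal (ln (real (packing_number X r)) / - ln r) \<le> ?g r"
    using eventually_at_right_less[of "0::real"] eventually_at_right_real[of 0 1, simplified]
  proof eventually_elim
    case (elim r)
    then show ?case
      using packing_exponent_le[OF assms(1,2) _ _ \<open>c > 0\<close> assms(3), of r s] * by simp
  qed
  then have "upper_minkowski_dim X \<le> Limsup (at_right 0) ?g"
    unfolding upper_minkowski_dim_def by (rule Limsup_mono)
  also have "\<dots> = ereal s"
    by (intro lim_imp_Limsup exponent_error_tendsto) simp
  finally show "upper_minkowski_dim X \<le> ereal s" .
qed

lemma lower_minkowski_dim_le_measure:
  assumes "compact X" "X \<noteq> {}" "finite_borel_measure_on X \<mu>"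
  shows "lower_minkowski_dim X \<le> lower_minkowski_dim_measure X \<mu>"
  unfolding lower_minkowski_dim_measure_def
proof (rule Inf_greatest, clarify)
  fix s c :: real and \<rho> :: "nat \<Rightarrow> real"
  assume "c > 0" and \<rho>: "\<forall>n. \<rho> n > 0" "\<rho> \<longlonglongrightarrow> 0"
    and *: "\<forall>x\<in>X. \<forall>n. c * \<rho> n powr s \<le> measure \<mu> (cball_in X x (\<rho> n))"
  let ?f = "\<lambda>r. ereal (ln (real (packing_number X r)) / - ln r)"
  let ?g = "\<lambda>r. ereal (s + ln (measure \<mu> X / c) / - ln r)"
  have lim: "filterlim \<rho> (at_right 0) sequentially"
    using \<rho> by (auto simp: filterlim_at less_imp_neq[symmetric])
  have g: "(\<lambda>n. ?g (\<rho> n)) \<longlonglongrightarrow> ereal s"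
    by (rule filterlim_compose[OF exponent_error_tendsto lim])
  have small: "\<forall>\<^sub>F n in sequentially. \<rho> n < 1"
    using order_tendstoD(2)[OF \<rho>(2), of 1] by simp
  show "lower_minkowski_dim X \<le> ereal s"
  proof (rule dense_le)
    fix y assume "y < lower_minkowski_dim X"
    then have "\<forall>\<^sub>F r in at_right 0. y < ?f r"
      unfolding lower_minkowski_dim_def by (rule less_LiminfD)
    then have "\<forall>\<^sub>F n in sequentially. y < ?f (\<rho> n)"
      using lim by (rule eventually_compose_filterlim)
    with small have "\<forall>\<^sub>F n in sequentially. y \<le> ?g (\<rho> n)"
    proof eventually_elim
      case (elim n)
      then have "?f (\<rho> n) \<le> ?g (\<rho> n)"
        using packing_exponent_le[OF assms(1,2) _ _ \<open>c > 0\<close> assms(3), of "\<rho> n" s] * \<rho>(1) by simp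
      with elim show ?case by (meson less_imp_le order_trans)
    qed
    then show "y \<le> ereal s"
      using g by (intro tendsto_lowerbound[of _ _ sequentially]) auto
  qed
qed

section \<open>A measure spread over maximum packings at all dyadic scales\<close>

text \<open>
  The weights have to be summable, and \<open>1 / scale_weight n\<close> has to grow subexponentially in
  \<open>n\<close>. This choice telescopes to total mass \<open>1\<close>, so the weights form a probability
  mass function.
\<close>

definition scale_weight :: "nat \<Rightarrow> real" where
  "scale_weight n = 1 / ((real n + 1) * (real n + 2))"

lemma scale_weight_pos: "scale_weight n > 0"
  by (simp add: scale_weight_def)

lemma scale_weight_sums: "scale_weight sums 1"
proof -
  have "(\<lambda>n. 1 / (real n + 1)) \<longlonglongrightarrow> 0" by real_asymp
  from telescope_sums'[OF this]
  have "(\<lambda>n. 1 / (real n + 1) - 1 / (real (Suc n) + 1)) sums 1" by simp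
  also have "(\<lambda>n. 1 / (real n + 1) - 1 / (real (Suc n) + 1)) = scale_weight"
    by (rule ext) (simp add: scale_weight_def divide_simps)
  finally show ?thesis .
qed

definition scale_pmf :: "nat pmf" where
  "scale_pmf = embed_pmf scale_weight"

lemma pmf_scale_pmf: "pmf scale_pmf n = scale_weight n"
  unfolding scale_pmf_def
proof (rule pmf_embed_pmf)
  show "0 \<le> scale_weight n" for n using scale_weight_pos[of n] by simp
  have "(\<integral>\<^sup>+ n. ennreal (scale_weight n) \<partial>count_space UNIV) = (\<Sum>n. ennreal (scale_weight n))"
    by (rule nn_integral_count_space_nat)
  also have "\<dots> = ennreal (\<Sum>n. scale_weight n)"
    using scale_weight_sums less_imp_le[OF scale_weight_pos]
    by (intro suminf_ennreal2) (auto simp: sums_iff)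
  finally show "(\<integral>\<^sup>+ n. ennreal (scale_weight n) \<partial>count_space UNIV) = 1"
    using scale_weight_sums by (simp add: sums_iff)
qed

lemma pmf_bind_ge: "pmf p n * pmf (q n) y \<le> pmf (bind_pmf p q) y"
proof -
  have "pmf p n * pmf (q n) y = (\<integral>k. indicator {n} k * pmf (q n) y \<partial>measure_pmf p)"
    by (simp add: measure_pmf_single)
  also have "\<dots> \<le> (\<integral>k. pmf (q k) y \<partial>measure_pmf p)"
    by (intro integral_mono measure_pmf.integrable_const_bound[where B = 1])
       (auto simp: indicator_def pmf_le_1)
  finally show ?thesis by (simp add: pmf_bind)
qed

text \<open>
  The mass bound holds because each of the \<open>N((1/2) ^ n)\<close> centres at scale \<open>n\<close>
  carries mass at least \<open>scale_weight n / N((1/2) ^ n)\<close>, and every ball of twice the scale contains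
  one of them. Since the scales tend to \<open>0\<close>, every ball has positive mass, so the support is all of
  \<open>X\<close>.
\<close>

lemma obtain_multiscale_measure:
  assumes "compact X" "X \<noteq> {}"
  obtains \<mu> where "\<mu> \<in> fully_supported_measures X"
    and "\<And>n x. x \<in> X \<Longrightarrow>
      scale_weight n / packing_number X ((1/2) ^ n) \<le> measure \<mu> (cball_in X x (2 * (1/2) ^ n))"
proof -
  have "\<forall>n. \<exists>C. packing_centres X ((1/2) ^ n) C \<and> card C = packing_number X ((1/2) ^ n)"
    using obtain_packing_centres[OF assms(1)]
    by (metis half_gt_zero_iff zero_less_one zero_less_power)
  then obtain C where C: "\<And>n. packing_centres X ((1/2) ^ n) (C n)"
      "\<And>n. card (C n) = packing_number X ((1/2) ^ n)" by metis
  have fin: "finite (C n)" and sub: "C n \<subseteq> X" for n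
    using C(1)[of n] by (auto simp: packing_centres_def)
  have ne: "C n \<noteq> {}" for n
    using packing_number_ge_1[OF assms, of "(1/2) ^ n"] C(2)[of n] by auto
  obtain x0 where x0: "x0 \<in> X" using assms(2) by blast
  define p where "p = bind_pmf scale_pmf (\<lambda>n. pmf_of_set (C n))"
  \<comment> \<open>The distribution \<open>p\<close> lives on the whole type but is concentrated on \<open>X\<close>, where
    \<open>h\<close> is the identity. The value \<open>x0\<close> outside \<open>X\<close> only makes \<open>h\<close> a total map
    into \<open>X\<close>, so that \<open>p\<close> can be transported to the Borel sets of \<open>X\<close>.\<close>
  define h where "h = (\<lambda>z. if z \<in> X then z else x0)"
  define \<mu> where "\<mu> = distr (measure_pmf p) (restrict_space borel X) h"
  have h: "h \<in> measurable (measure_pmf p) (restrict_space borel X)"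
    using x0 by (auto simp: h_def measurable_def space_restrict_space)
  have sets: "sets \<mu> = sets (restrict_space borel X)" by (simp add: \<mu>_def)
  have fbm: "finite_borel_measure_on X \<mu>"
    unfolding finite_borel_measure_on_def \<mu>_def
    using h by (auto intro: measure_pmf.finite_measure_distr)
  then interpret finite_measure \<mu> by (simp add: finite_borel_measure_on_def)
  have space: "space \<mu> = X" by (rule space_finite_borel_measure_on[OF fbm])
  have lower: "scale_weight n / packing_number X ((1/2) ^ n)
      \<le> measure \<mu> (cball_in X x (2 * (1/2) ^ n))" if x: "x \<in> X" for n x
  proof -
    let ?B = "cball_in X x (2 * (1/2) ^ n)"
    obtain y where y: "y \<in> C n" "y \<in> ?B"
      using maximum_packing_centres_dense[OF assms(1) _ C(1,2) x] by auto
    have "scale_weight n / packing_number X ((1/2) ^ n)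
        = pmf scale_pmf n * pmf (pmf_of_set (C n)) y"
      using fin ne y(1) by (simp add: pmf_scale_pmf C(2))
    also have "\<dots> \<le> pmf p y" unfolding p_def by (rule pmf_bind_ge)
    also have "\<dots> = measure p {y}" by (simp add: measure_pmf_single)
    also have "\<dots> \<le> measure p (h -` ?B \<inter> space p)"
      using y sub by (intro measure_pmf.finite_measure_mono) (auto simp: h_def)
    also have "\<dots> = measure \<mu> ?B"
      unfolding \<mu>_def using h cball_in_sets by (rule measure_distr[symmetric])
    finally show ?thesis .
  qed
  have "x \<in> measure_support \<mu>" if x: "x \<in> X" for x
    unfolding measure_support_def
  proof (clarsimp simp: space x)
    fix U :: "'a set" assume "open U" "x \<in> U"
    then obtain e where e: "e > 0" "cball x e \<subseteq> U" by (auto simp: open_contains_cball)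
    obtain n where "(1/2) ^ n < e / 2" using real_arch_pow_inv[of "e/2" "1/2"] e(1) by auto
    then have sub: "cball_in X x (2 * (1/2) ^ n) \<subseteq> X \<inter> U"
      using e(2) by (auto simp: cball_in_def)
    have "0 < scale_weight n / packing_number X ((1/2) ^ n)"
      using packing_number_ge_1[OF assms, of "(1/2) ^ n"] scale_weight_pos[of n] by simp
    also note lower[OF x]
    also have "measure \<mu> (cball_in X x (2 * (1/2) ^ n)) \<le> measure \<mu> (X \<inter> U)"
      using \<open>open U\<close> by (intro finite_measure_mono[OF sub]) (auto simp: sets sets_restrict_space)
    finally show "0 < emeasure \<mu> (X \<inter> U)"
      by (simp add: emeasure_eq_measure)
  qed
  then have "measure_support \<mu> = X" by (auto simp: measure_support_def space)
  with fbm have "\<mu> \<in> fully_supported_measures X" by (simp add: fully_supported_measures_def)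
  then show thesis using lower by (rule that)
qed

section \<open>The multiscale measure has the dimensions of the space\<close>

text \<open>
  Replacing the exponent \<open>t\<close> by a larger \<open>s\<close> gains the factor \<open>2 powr ((s - t) * n)\<close>,
  which absorbs the quadratic growth of \<open>1 / scale_weight n\<close>. The constant does not depend
  on \<open>n\<close>, so the lemma serves for all scales as well as for a subsequence.
\<close>

lemma scale_weight_subexponential:
  fixes s t K :: real
  assumes "t < s" "K > 0"
  obtains c where "c > 0" and
    "\<And>n N. 1 \<le> N \<Longrightarrow> N \<le> K * ((1/2) ^ n) powr - t \<Longrightarrow> c * ((1/2) ^ n) powr s \<le> scale_weight n / N"
proof -
  define u where "u = s - t"
  have "u > 0" using assms by (simp add: u_def)
  then have "(\<lambda>n. (real n + 1) * (real n + 2) * 2 powr (- u * real n)) \<longlonglongrightarrow> 0" by real_asymp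
  then have "Bseq (\<lambda>n. (real n + 1) * (real n + 2) * 2 powr (- u * real n))"
    by (intro convergent_imp_Bseq convergentI)
  then obtain B where B: "B > 0"
    "\<And>n. norm ((real n + 1) * (real n + 2) * 2 powr (- u * real n)) \<le> B"
    by (auto simp: Bseq_def)
  have half: "((1/2) ^ n) powr a = 2 powr (- a * real n)" for n and a :: real
    by (simp add: powr_realpow[symmetric] powr_powr powr_divide powr_minus_divide mult.commute)
  show thesis
  proof (rule that[of "1 / (K * B)"])
    show "1 / (K * B) > 0" using assms B by simp
    fix n and N :: real
    assume N: "1 \<le> N" "N \<le> K * ((1/2) ^ n) powr - t"
    have "N * ((real n + 1) * (real n + 2)) * ((1/2) ^ n) powr s
        \<le> K * ((1/2) ^ n) powr - t * ((real n + 1) * (real n + 2)) * ((1/2) ^ n) powr s"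
      using N by (intro mult_right_mono) auto
    also have "\<dots> = K * ((real n + 1) * (real n + 2) * 2 powr (- u * real n))"
      unfolding half by (simp add: u_def powr_add[symmetric] algebra_simps)
    also have "\<dots> \<le> K * B"
      using B(2)[of n] assms(2) by (intro mult_left_mono) auto
    finally have "((1/2) ^ n) powr s * (N * ((real n + 1) * (real n + 2))) \<le> K * B"
      by (simp add: mult_ac)
    moreover have "0 < N * ((real n + 1) * (real n + 2))" using N(1) by simp
    ultimately have "((1/2) ^ n) powr s \<le> K * B / (N * ((real n + 1) * (real n + 2)))"
      by (subst pos_le_divide_eq)
    also have "\<dots> = K * B * (scale_weight n / N)" by (simp add: scale_weight_def)
    finally show "1 / (K * B) * ((1/2) ^ n) powr s \<le> scale_weight n / N"
      using B(1) assms(2) by (simp add: divide_le_eq mult.commute)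
  qed
qed

lemma dyadic_bracket:
  fixes r :: real
  assumes "0 < r" "r \<le> 1"
  obtains n where "(1/2) ^ Suc n < r" "r \<le> (1/2) ^ n"
proof -
  obtain k where k: "(1/2) ^ k < r" using real_arch_pow_inv[of r "1/2"] assms by auto
  define m where "m = (LEAST k. (1/2) ^ k < r)"
  have m: "(1/2) ^ m < r" unfolding m_def using k by (rule LeastI)
  then have "m \<noteq> 0" using assms by (cases m) auto
  then obtain n where n: "m = Suc n" by (cases m) auto
  then have "\<not> (1/2) ^ n < r" using not_less_Least[of n "\<lambda>k. (1/2) ^ k < r"] by (simp add: m_def)
  then show thesis using that[of n] m n by simp
qed

lemma packing_exponent_nonneg:
  assumes "compact X" "X \<noteq> {}" "0 < r" "r < 1"
  shows "0 \<le> ln (real (packing_number X r)) / - ln r"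
  using packing_number_ge_1[OF assms(1-3)] assms by (intro divide_nonneg_pos) auto

lemma packing_number_le_powr:
  assumes "compact X" "X \<noteq> {}" "0 < r" "r < 1"
    and "ln (real (packing_number X r)) / - ln r < t"
  shows "real (packing_number X r) \<le> r powr - t"
proof -
  have "real (packing_number X r) \<ge> 1" using packing_number_ge_1[OF assms(1-3)] by simp
  moreover have "ln (real (packing_number X r)) \<le> - t * ln r"
    using assms by (simp add: divide_simps split: if_splits)
  ultimately have "real (packing_number X r) \<le> exp (- t * ln r)"
    by (metis exp_le_cancel_iff exp_ln less_le_trans zero_less_one)
  also have "\<dots> = r powr - t" using assms by (simp add: powr_def)
  finally show ?thesis .
qed

text \<open>
  For \<open>t\<close> above the upper dimension, \<open>N(r) \<le> r powr - t\<close> holds for small \<open>r\<close>.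
  Since \<open>N\<close> is antitone, a constant factor extends the bound to all \<open>r \<le> 1\<close>, and the
  multiscale mass bound at a dyadic scale comparable to \<open>r\<close> gives every exponent \<open>s > t\<close>.
\<close>

lemma upper_minkowski_dim_measure_le:
  assumes "compact X" "X \<noteq> {}" "finite_borel_measure_on X \<mu>"
    and lower: "\<And>n x. x \<in> X \<Longrightarrow>
      scale_weight n / packing_number X ((1/2) ^ n) \<le> measure \<mu> (cball_in X x (2 * (1/2) ^ n))"
  shows "upper_minkowski_dim_measure X \<mu> \<le> upper_minkowski_dim X"
proof (rule dense_ge)
  fix y assume "upper_minkowski_dim X < y"
  then obtain s where s: "upper_minkowski_dim X < ereal s" "ereal s < y"
    using ereal_dense2 by blast
  then obtain t where t: "upper_minkowski_dim X < ereal t" "t < s"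
    using ereal_dense2[OF s(1)] by auto
  interpret finite_measure \<mu> using assms(3) by (simp add: finite_borel_measure_on_def)
  have "\<forall>\<^sub>F r in at_right 0. ln (real (packing_number X r)) / - ln r < t"
    using Limsup_lessD[OF t(1)[unfolded upper_minkowski_dim_def]] by simp
  then obtain b where b: "b > 0"
    "\<And>r. 0 < r \<Longrightarrow> r < b \<Longrightarrow> ln (real (packing_number X r)) / - ln r < t"
    by (auto simp: eventually_at_right_field)
  define r0 where "r0 = min b 1 / 2"
  have r0: "0 < r0" "r0 < b" "r0 < 1" using b by (auto simp: r0_def)
  have t0: "t > 0"
    using packing_exponent_nonneg[OF assms(1,2) r0(1,3)] b(2)[OF r0(1,2)] by linarith
  define K where "K = real (packing_number X r0)"
  have K: "K \<ge> 1" unfolding K_def using packing_number_ge_1[OF assms(1,2) r0(1)] by simp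
  have N_le: "real (packing_number X r) \<le> K * r powr - t" if r: "0 < r" "r \<le> 1" for r
  proof (cases "r < r0")
    case True
    then have "real (packing_number X r) \<le> 1 * r powr - t"
      using packing_number_le_powr[OF assms(1,2) r(1) _ b(2)] r r0 by simp
    also have "\<dots> \<le> K * r powr - t" using K by (intro mult_right_mono) auto
    finally show ?thesis .
  next
    case False
    then have "real (packing_number X r) \<le> K * 1"
      using packing_number_antimono[OF assms(1) r0(1)] by (simp add: K_def)
    also have "r powr t \<le> 1" using powr_mono2[of t r 1] r t0 by simp
    then have "1 \<le> r powr - t" using r by (simp add: powr_minus_divide)
    then have "K * 1 \<le> K * r powr - t" using K by (intro mult_left_mono) auto
    finally show ?thesis .
  qed
  obtain c where c: "c > 0"
    "\<And>n N. 1 \<le> N \<Longrightarrow> N \<le> K * ((1/2) ^ n) powr - t \<Longrightarrow> c * ((1/2) ^ n) powr s \<le> scale_weight n / N"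
    using scale_weight_subexponential[OF t(2), of K] K by auto
  have "c / 4 powr s * r powr s \<le> measure \<mu> (cball_in X x r)"
    if "x \<in> X" "0 < r" "r < 1" for x r
  proof -
    obtain n where n: "(1/2) ^ Suc n < r" "r \<le> (1/2) ^ n"
      using dyadic_bracket[of r] \<open>0 < r\<close> \<open>r < 1\<close> by auto
    \<comment> \<open>Two steps finer than \<open>n\<close>: the mass bound concerns the radius \<open>2 * d\<close>, which must not
      exceed \<open>r\<close>.\<close>
    define d where "d = (1/2 :: real) ^ (n + 2)"
    have d: "0 < d" "d \<le> 1" "2 * d \<le> r" "r / 4 \<le> d"
      using n unfolding d_def by (simp_all add: power_le_one del: power_Suc)
        (simp_all add: power_add)
    have "c / 4 powr s * r powr s = c * (r / 4) powr s"
      using \<open>0 < r\<close> by (simp add: powr_divide)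
    also have "\<dots> \<le> c * d powr s"
      using \<open>c > 0\<close> d \<open>0 < r\<close> t0 t(2) by (intro mult_left_mono powr_mono2) auto
    also have "\<dots> \<le> scale_weight (n + 2) / packing_number X d"
      unfolding d_def
      using packing_number_ge_1[OF assms(1,2) d(1)] N_le[OF d(1,2)]
      by (intro c(2)) (simp_all add: d_def)
    also have "\<dots> \<le> measure \<mu> (cball_in X x (2 * d))"
      unfolding d_def by (rule lower[OF \<open>x \<in> X\<close>])
    also have "\<dots> \<le> measure \<mu> (cball_in X x r)"
      using assms(3) cball_in_sets
      by (intro finite_measure_mono cball_in_mono d) (auto simp: finite_borel_measure_on_def)
    finally show ?thesis .
  qed
  moreover have "c / 4 powr s > 0" using c by simp
  ultimately have "upper_minkowski_dim_measure X \<mu> \<le> ereal s"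
    unfolding upper_minkowski_dim_measure_def
    using t0 t(2) by (intro Inf_lower CollectI exI[of _ s]) (auto intro!: exI[of _ "c / 4 powr s"])
  with s(2) show "upper_minkowski_dim_measure X \<mu> \<le> y" by simp
qed

text \<open>
  For \<open>t\<close> above the lower dimension, \<open>N(r) \<le> r powr - t\<close> holds at arbitrarily small
  \<open>r\<close>, and such \<open>r\<close> need not be dyadic. Because \<open>N\<close> is antitone, the bound passes
  to the next larger dyadic scale at the cost of a factor \<open>2 powr t\<close>. So the fixed dyadic scales
  also reach the limit inferior.
\<close>

lemma lower_minkowski_dim_measure_le:
  assumes "compact X" "X \<noteq> {}"
    and lower: "\<And>n x. x \<in> X \<Longrightarrow>
      scale_weight n / packing_number X ((1/2) ^ n) \<le> measure \<mu> (cball_in X x (2 * (1/2) ^ n))"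
  shows "lower_minkowski_dim_measure X \<mu> \<le> lower_minkowski_dim X"
proof (rule dense_ge)
  fix y assume "lower_minkowski_dim X < y"
  then obtain s where s: "lower_minkowski_dim X < ereal s" "ereal s < y"
    using ereal_dense2 by blast
  then obtain t where t: "lower_minkowski_dim X < ereal t" "t < s"
    using ereal_dense2[OF s(1)] by auto
  let ?f = "\<lambda>r. ln (real (packing_number X r)) / - ln r"
  have freq: "\<exists>r. 0 < r \<and> r < b \<and> ?f r < t" if "b > 0" for b
  proof (rule ccontr)
    assume "\<not> ?thesis"
    then have "\<forall>\<^sub>F r in at_right 0. ereal t \<le> ereal (?f r)"
      unfolding eventually_at_right_field using \<open>b > 0\<close>
      by (intro exI[of _ b]) (simp add: not_less, meson linorder_not_le)
    then have "ereal t \<le> lower_minkowski_dim X"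
      unfolding lower_minkowski_dim_def by (rule Liminf_bounded)
    with t(1) show False by simp
  qed
  have t0: "t > 0"
  proof -
    obtain r where "0 < r" "r < 1" "?f r < t" using freq[of 1] by auto
    with packing_exponent_nonneg[OF assms(1,2), of r] show ?thesis by linarith
  qed
  have "\<exists>n\<ge>m. real (packing_number X ((1/2) ^ n)) \<le> 2 powr t * ((1/2) ^ n) powr - t" for m
  proof -
    obtain r where r: "0 < r" "r < (1/2) ^ Suc m" "?f r < t"
      using freq[of "(1/2) ^ Suc m"] by auto
    have "(1/2 :: real) ^ Suc m < 1" by (rule power_Suc_less_one) auto
    with r have "r < 1" by simp
    obtain n where n: "(1/2) ^ Suc n < r" "r \<le> (1/2) ^ n"
      using dyadic_bracket[of r] r \<open>r < 1\<close> by auto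
    have "(1/2 :: real) ^ Suc n < (1/2) ^ Suc m" using n(1) r(2) by linarith
    then have "m \<le> n" by (subst (asm) power_strict_decreasing_iff) auto
    have "real (packing_number X ((1/2) ^ n)) \<le> real (packing_number X r)"
      using packing_number_antimono[OF assms(1) r(1) n(2)] by simp
    also have "\<dots> \<le> r powr - t"
      by (rule packing_number_le_powr[OF assms(1,2) r(1) \<open>r < 1\<close> r(3)])
    also have "\<dots> \<le> ((1/2) ^ Suc n) powr - t"
      using n(1) t0 by (intro powr_mono2') auto
    also have "\<dots> = 2 powr t * ((1/2) ^ n) powr - t"
      by (simp add: powr_mult powr_minus_divide powr_divide)
    finally show ?thesis using \<open>m \<le> n\<close> by blast
  qed
  then obtain \<nu> where \<nu>: "\<And>m. \<nu> m \<ge> m"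
    "\<And>m. real (packing_number X ((1/2) ^ \<nu> m)) \<le> 2 powr t * ((1/2) ^ \<nu> m) powr - t"
    by metis
  obtain c where c: "c > 0"
    "\<And>n N. 1 \<le> N \<Longrightarrow> N \<le> 2 powr t * ((1/2) ^ n) powr - t \<Longrightarrow>
       c * ((1/2) ^ n) powr s \<le> scale_weight n / N"
    using scale_weight_subexponential[OF t(2), of "2 powr t"] by auto
  define \<rho> where "\<rho> = (\<lambda>m. 2 * (1/2 :: real) ^ \<nu> m)"
  have pos: "\<forall>m. \<rho> m > 0" by (simp add: \<rho>_def)
  have "filterlim \<nu> at_top sequentially"
    by (rule filterlim_at_top_mono[OF filterlim_ident]) (simp add: \<nu>(1))
  then have "(\<lambda>m. (1/2 :: real) ^ \<nu> m) \<longlonglongrightarrow> 0"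
    by (rule filterlim_compose[rotated]) (rule LIMSEQ_power_zero, simp)
  then have lim: "\<rho> \<longlonglongrightarrow> 0"
    unfolding \<rho>_def by (rule tendsto_mult_right_zero)
  have mass: "c / 2 powr s * \<rho> m powr s \<le> measure \<mu> (cball_in X x (\<rho> m))" if "x \<in> X" for x m
  proof -
    have "c / 2 powr s * \<rho> m powr s = c * ((1/2) ^ \<nu> m) powr s"
      by (simp add: \<rho>_def powr_mult)
    also have "\<dots> \<le> scale_weight (\<nu> m) / packing_number X ((1/2) ^ \<nu> m)"
      using packing_number_ge_1[OF assms(1,2), of "(1/2) ^ \<nu> m"] \<nu>(2) by (intro c(2)) simp_all
    also have "\<dots> \<le> measure \<mu> (cball_in X x (\<rho> m))"
      unfolding \<rho>_def by (rule lower[OF that])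
    finally show ?thesis .
  qed
  have "c / 2 powr s > 0" using c by simp
  then have "\<exists>c>0. \<exists>\<rho> :: nat \<Rightarrow> real. (\<forall>n. \<rho> n > 0) \<and> \<rho> \<longlonglongrightarrow> 0 \<and>
      (\<forall>x\<in>X. \<forall>n. c * \<rho> n powr s \<le> measure \<mu> (cball_in X x (\<rho> n)))"
    using pos lim mass by blast
  then have "lower_minkowski_dim_measure X \<mu> \<le> ereal s"
    unfolding lower_minkowski_dim_measure_def
    using t0 t(2) by (intro Inf_lower CollectI exI[of _ s]) auto
  with s(2) show "lower_minkowski_dim_measure X \<mu> \<le> y" by simp
qed

theorem theorem2p1:
  fixes X :: "'a::metric_space set"
  assumes "compact X" and "X \<noteq> {}"
  shows "is_minimum (upper_minkowski_dim X)
           {upper_minkowski_dim_measure X \<mu> | \<mu>. \<mu> \<in> fully_supported_measures X} \<and>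
         is_minimum (lower_minkowski_dim X)
           {lower_minkowski_dim_measure X \<mu> | \<mu>. \<mu> \<in> fully_supported_measures X}"
proof -
  have fbm: "finite_borel_measure_on X \<mu>" if "\<mu> \<in> fully_supported_measures X" for \<mu>
    using that by (simp add: fully_supported_measures_def)
  obtain \<mu> where \<mu>: "\<mu> \<in> fully_supported_measures X"
    "\<And>n x. x \<in> X \<Longrightarrow>
      scale_weight n / packing_number X ((1/2) ^ n) \<le> measure \<mu> (cball_in X x (2 * (1/2) ^ n))"
    using obtain_multiscale_measure[OF assms] by blast
  have "upper_minkowski_dim X = upper_minkowski_dim_measure X \<mu>"
    using upper_minkowski_dim_le_measure[OF assms fbm[OF \<mu>(1)]]
      upper_minkowski_dim_measure_le[OF assms fbm[OF \<mu>(1)] \<mu>(2)] by (rule antisym)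
  moreover have "lower_minkowski_dim X = lower_minkowski_dim_measure X \<mu>"
    using lower_minkowski_dim_le_measure[OF assms fbm[OF \<mu>(1)]]
      lower_minkowski_dim_measure_le[OF assms \<mu>(2)] by (rule antisym)
  ultimately show ?thesis
    unfolding is_minimum_def
    using \<mu>(1) upper_minkowski_dim_le_measure[OF assms fbm]
      lower_minkowski_dim_le_measure[OF assms fbm] by blast
qed

end
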